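(* Let $\mathcal{B}\subset\Sigma_{2\times 2}(2)$ and let $\beta_1,\beta_2,\dots,\beta_k\in\{1,4\}$, $k\ge 1$. Then, for any $m\ge 1$, $$h(\mathcal{B})\ge\frac{1}{mk}\log\rho\left(S_{m;\beta_1}S_{m;\beta_2}\cdots S_{m;\beta_k}\right)$$ and $$h(\mathcal{B})\ge\frac{1}{mk}\log\rho\left(W_{m;\beta_1}W_{m;\beta_2}\cdots W_{m;\beta_k}\right),$$ where $\rho(A)$ is the maximum eigenvalue of the (nonnegative) matrix $A$.
   Context: A Wang tile with two symbols is a unit square with colored edges, identified with the quadruple $B=(b(B),l(B),t(B),r(B))\in\{0,1\}^4$ of the colors of its bottom, left, top and right edges. $\Sigma_{2\times 2}(2)$ is the set of all 16 such tiles. For $\mathcal{B}\subset\Sigma_{2\times2}(2)$ and $m,n\ge 2$, $\Sigma_{m\times n}(\mathcal{B})$ is the set of all $\mathcal{B}$-admissible patterns on the lattice $\mathbb{Z}_{m\times n}=\{(i,j):0\le i\le m-1,\,0\le j\le n-1\}$, i.e. all arrays $(T_{i,j})_{0\le i\le m-2,\,0\le j\le n-2}$ of tiles of $\mathcal{B}$ with $r(T_{i,j})=l(T_{i+1,j})$ and $t(T_{i,j})=b(T_{i,j+1})$ whenever both tiles are in the array (tiles may not be rotated or reflected). Let $\Gamma_{m\times n}(\mathcal{B})=|\Sigma_{m\times n}(\mathcal{B})|$. The spatial entropy is $h(\mathcal{B})=\lim_{m,n\to\infty}\frac{\log\Gamma_{m\times n}(\mathcal{B})}{mn}$, with the convention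 $h(\mathcal{B})=0$ if $\Gamma_{m\times n}(\mathcal{B})=0$ for some $m,n$. Also $\log 0=-\infty$. Counting function: $\psi(u_1,\dots,u_n)=1+\sum_{k=1}^n u_k2^{n-k}$ for $u_i\in\{0,1\}$. Horizontal connecting operator: for $m\ge1$ and $1\le\alpha\le4$, $S_{m;\alpha}$ is the $2^m\times2^m$ matrix whose $(k,l)$ entry, with $k=\psi(k_1,\dots,k_m)$, $l=\psi(l_1,\dots,l_m)$, $\alpha=\psi(\alpha_1,\alpha_2)$, is the number of horizontal rows of $m$ tiles $T_1,\dots,T_m\in\mathcal{B}$ (left to right) with $r(T_i)=l(T_{i+1})$ for $1\le i\le m-1$, leftmost edge color $l(T_1)=\alpha_1$, rightmost edge color $r(T_m)=\alpha_2$, bottom colors $b(T_i)=k_i$ and top colors $t(T_i)=l_i$ for $1\le i\le m$. (Thus $\alpha=1$ means $\alpha_1=\alpha_2=0$ and $\alpha=4$ means $\alpha_1=\alpha_2=1$.) Vertical connecting operator: similarly, $W_{m;\alpha}$ is the $2^m\times2^m$ matrix whose $(k,l)$ entry is the number of vertical columns of $m$ tiles $T_1,\dots,T_m\in\mathcal{B}$ (bottom to top) with $t(T_i)=b(T_{i+1})$ for $1\le i\le m-1$, $b(T_1)=\alpha_1$, $t(T_m)=\alpha_2$, left colors $l(T_i)=k_i$ and right colors $r(T_i)=l_i$ for $1\le i\le m$. *)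

theory Defs
  imports
    "HOL-Analysis.Analysis"
    "Jordan_Normal_Form.Spectral_Radius"
begin

datatype tile = Tile (bot_col: nat) (left_col: nat) (top_col: nat) (right_col: nat)

definition all_tiles :: "tile set" where
  "all_tiles = {T. {bot_col T, left_col T, top_col T, right_col T} \<subseteq> {0, 1}}"

text \<open>
  A pattern on the \<open>m \<times> n\<close> lattice of vertices consists of \<open>(m - 1) \<times> (n - 1)\<close> tiles.  It is an
  extensional function, so that the set below counts each array once.
\<close>

definition patterns :: "tile set \<Rightarrow> nat \<Rightarrow> nat \<Rightarrow> (nat \<times> nat \<Rightarrow> tile) set" where
  "patterns B m n =
     {T \<in> {..<m - 1} \<times> {..<n - 1} \<rightarrow>\<^sub>E B.
        (\<forall>i j. i + 1 < m - 1 \<longrightarrow> j < n - 1 \<longrightarrow> right_col (T (i, j)) = left_col (T (i + 1, j))) \<and>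
        (\<forall>i j. i < m - 1 \<longrightarrow> j + 1 < n - 1 \<longrightarrow> top_col (T (i, j)) = bot_col (T (i, j + 1)))}"

definition num_patterns :: "tile set \<Rightarrow> nat \<Rightarrow> nat \<Rightarrow> nat" where
  "num_patterns B m n = card (patterns B m n)"

text \<open>The limit is the joint one: \<open>m\<close> and \<open>n\<close> tend to infinity independently of each other.\<close>

definition entropy :: "tile set \<Rightarrow> real" where
  "entropy B =
     (if \<exists>m\<ge>2. \<exists>n\<ge>2. num_patterns B m n = 0 then 0
      else Lim (at_top \<times>\<^sub>F at_top)
             (\<lambda>(m, n). ln (real (num_patterns B m n)) / (real m * real n)))"

text \<open>The counting function; the entry \<open>u ! k\<close> is the argument with one-based index \<open>k + 1\<close>.\<close>

definition psi :: "nat list \<Rightarrow> nat" where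
  "psi u = 1 + (\<Sum>k<length u. u ! k * 2 ^ (length u - 1 - k))"

text \<open>
  Matrix indices are zero-based here, so the entry with one-based index \<open>(k, l)\<close> has index
  \<open>(k - 1, l - 1)\<close>.  On words of length \<open>m\<close> over \<open>{0, 1}\<close>, the map \<^const>\<open>psi\<close> is a bijection onto
  \<open>{1..2 ^ m}\<close>; for \<open>B \<subseteq> all_tiles\<close>, the equations between values of \<^const>\<open>psi\<close> therefore
  prescribe the boundary colors one by one.
\<close>

definition S_mat :: "tile set \<Rightarrow> nat \<Rightarrow> nat \<Rightarrow> real mat" where
  "S_mat B m \<alpha> = mat (2 ^ m) (2 ^ m) (\<lambda>(k, l).
     real (card {Ts. length Ts = m \<and> set Ts \<subseteq> B \<and>
       (\<forall>i. i + 1 < m \<longrightarrow> right_col (Ts ! i) = left_col (Ts ! (i + 1))) \<and>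
       psi [left_col (hd Ts), right_col (last Ts)] = \<alpha> \<and>
       psi (map bot_col Ts) = k + 1 \<and> psi (map top_col Ts) = l + 1}))"

definition W_mat :: "tile set \<Rightarrow> nat \<Rightarrow> nat \<Rightarrow> real mat" where
  "W_mat B m \<alpha> = mat (2 ^ m) (2 ^ m) (\<lambda>(k, l).
     real (card {Ts. length Ts = m \<and> set Ts \<subseteq> B \<and>
       (\<forall>i. i + 1 < m \<longrightarrow> top_col (Ts ! i) = bot_col (Ts ! (i + 1))) \<and>
       psi [bot_col (hd Ts), top_col (last Ts)] = \<alpha> \<and>
       psi (map left_col Ts) = k + 1 \<and> psi (map right_col Ts) = l + 1}))"

definition mat_prod :: "nat \<Rightarrow> real mat list \<Rightarrow> real mat" where
  "mat_prod d As = foldr (*) As (1\<^sub>m d)"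

text \<open>
  The spectrum of a real matrix consists of its real eigenvalues only.  For a nonnegative square
  matrix of positive dimension it is finite and, by Perron--Frobenius, nonempty.
\<close>

definition max_eigenvalue :: "real mat \<Rightarrow> real" where
  "max_eigenvalue A = Max (spectrum A)"

text \<open>The library has \<open>ln 0 = 0\<close>; this logarithm has the value \<open>-\<infinity>\<close> at \<open>0\<close>.\<close>

definition log_ereal :: "real \<Rightarrow> ereal" where
  "log_ereal x = (if x > 0 then ereal (ln x) else -\<infinity>)"

end

(*
  Let P be the product of the S(m; beta_j) and r > 0 its largest eigenvalue.  The row sums of P^q count
  the strips of width m and height q k whose left and right boundary colors agree and are prescribed by
  beta, and one of these row sums is at least r^q.  Strips with equal boundary colors can be placed
  side by side independently, so there are at least r^(p q) patterns of p m by q k tiles.  As the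
  logarithm of the number of patterns is subadditive in each direction, Fekete's lemma in two variables
  shows that the limit defining the entropy exists and is the infimum of the quotients, whence it is at
  least log r / (m k).  Reflection in the diagonal exchanges S and W.  Since the maximum of an
  empty spectrum would be arbitrary, it also matters that a nonnegative matrix has a real eigenvalue.
*)

theory Submission
  imports Defs
begin

section \<open>Real eigenvalues of nonnegative matrices\<close>

text \<open>Points are functions on all naturals that vanish from \<open>n\<close> on, so that
  \<open>n\<close> can be an ordinary variable and the topology is the product topology.\<close>

definition std_simplex :: "nat \<Rightarrow> (nat \<Rightarrow> real) set" where
  "std_simplex n = {x. (\<forall>i. 0 \<le> x i) \<and> (\<forall>i\<ge>n. x i = 0) \<and> (\<Sum>i<n. x i) = 1}"

lemma std_simplex_le_1:
  assumes "x \<in> std_simplex n"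
  shows "x i \<le> 1"
proof (cases "i < n")
  case True
  then have "x i \<le> (\<Sum>i<n. x i)"
    using assms by (intro member_le_sum) (auto simp: std_simplex_def)
  then show ?thesis using assms by (simp add: std_simplex_def)
qed (use assms in \<open>auto simp: std_simplex_def\<close>)

lemma continuous_on_coordinate [continuous_intros]:
  fixes f :: "'a::topological_space \<Rightarrow> nat \<Rightarrow> real"
  assumes "continuous_on S f"
  shows "continuous_on S (\<lambda>x. f x i)"
  using assms by (rule continuous_on_product_then_coordinatewise)

text \<open>A closed subset of a product of unit intervals, which is compact by Tychonoff's
  theorem.\<close>

lemma compact_std_simplex: "compact (std_simplex n)"
proof -
  have "compactin (product_topology (\<lambda>_::nat. euclidean) UNIV) (PiE UNIV (\<lambda>_. {0..1::real}))"
    unfolding compactin_PiE by auto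
  then have "compact (PiE (UNIV :: nat set) (\<lambda>_. {0..1::real}))"
    by (simp add: euclidean_product_topology)
  moreover have "closed {x :: nat \<Rightarrow> real. (\<forall>i. 0 \<le> x i) \<and> (\<forall>i. i \<ge> n \<longrightarrow> x i = 0) \<and> (\<Sum>i<n. x i) = 1}"
    by (intro closed_Collect_conj closed_Collect_all closed_Collect_imp closed_Collect_eq
        closed_Collect_le continuous_intros) auto
  ultimately have "compact (PiE UNIV (\<lambda>_. {0..1}) \<inter> std_simplex n)"
    unfolding std_simplex_def by (auto intro!: compact_Int_closed)
  moreover have "PiE UNIV (\<lambda>_. {0..1}) \<inter> std_simplex n = std_simplex n"
    using std_simplex_le_1 by (auto simp: std_simplex_def)
  ultimately show ?thesis by simp
qed

text \<open>Summing the inequalities over \<open>i\<close> leaves \<open>t\<close> on the left,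
  since the coordinates sum to 1. The bound confines the values \<open>t\<close>, and later the
  eigenvalues, to a compact interval.\<close>

lemma sum_mult_simplex_le:
  assumes a: "\<And>i j. i < n \<Longrightarrow> j < n \<Longrightarrow> 0 \<le> a i j"
    and x: "x \<in> std_simplex n"
    and t: "\<And>i. i < n \<Longrightarrow> t * x i \<le> (\<Sum>j<n. a i j * x j)"
  shows "t \<le> (\<Sum>i<n. \<Sum>j<n. a i j)"
proof -
  have "t = (\<Sum>i<n. t * x i)"
    using x by (simp add: std_simplex_def flip: sum_distrib_left)
  also have "\<dots> \<le> (\<Sum>i<n. \<Sum>j<n. a i j * x j)"
    using t by (intro sum_mono) auto
  also have "\<dots> \<le> (\<Sum>i<n. \<Sum>j<n. a i j)"
    using a std_simplex_le_1[OF x] by (intro sum_mono mult_left_le) auto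
  finally show ?thesis .
qed

text \<open>Collatz--Wielandt: the largest \<open>t\<close> with \<open>t x \<le> a x\<close> for some \<open>x\<close> in the simplex is an eigenvalue,
  since otherwise replacing \<open>x\<close> by \<open>a x\<close> makes all inequalities strict and \<open>t\<close> can be increased.\<close>

lemma positive_eigenvector_exists:
  fixes a :: "nat \<Rightarrow> nat \<Rightarrow> real"
  assumes n: "n > 0" and pos: "\<And>i j. i < n \<Longrightarrow> j < n \<Longrightarrow> 0 < a i j"
  shows "\<exists>r\<ge>0. \<exists>x\<in>std_simplex n. \<forall>i<n. (\<Sum>j<n. a i j * x j) = r * x i"
proof -
  define C where "C = (\<Sum>i<n. \<Sum>j<n. a i j)"
  define D where "D = {p :: real \<times> (nat \<Rightarrow> real).
     \<forall>i. i < n \<longrightarrow> fst p * snd p i \<le> (\<Sum>j<n. a i j * snd p j)}"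
  define K where "K = ({0..C} \<times> std_simplex n) \<inter> D"
  have C: "C \<ge> 0" unfolding C_def by (intro sum_nonneg) (auto intro: less_imp_le[OF pos])
  have "closed D" unfolding D_def
    by (intro closed_Collect_all closed_Collect_imp closed_Collect_le continuous_intros) auto
  then have "compact K" unfolding K_def
    by (intro compact_Int_closed compact_Times compact_std_simplex) auto
  \<comment> \<open>Nonemptiness of \<open>K\<close>: for nonnegative \<open>a\<close> the value 0
    is admissible with every point of the simplex, here the first unit vector.\<close>
  moreover have "(0, \<lambda>i. if i = 0 then 1 else 0) \<in> K"
    using n C by (auto simp: K_def D_def std_simplex_def intro!: sum_nonneg less_imp_le[OF pos])
  moreover have "continuous_on K fst" by (intro continuous_intros)
  ultimately have "\<exists>p\<in>K. \<forall>q\<in>K. fst q \<le> fst p" by (intro continuous_attains_sup) auto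
  then obtain p where p: "p \<in> K" "\<And>q. q \<in> K \<Longrightarrow> fst q \<le> fst p" by blast
  define r x where "r = fst p" and "x = snd p"
  have r: "r \<ge> 0" and x: "x \<in> std_simplex n"
    and le: "\<And>i. i < n \<Longrightarrow> r * x i \<le> (\<Sum>j<n. a i j * x j)"
    using p(1) by (auto simp: K_def D_def r_def x_def)
  have max: "t \<le> r" if "t \<ge> 0" "y \<in> std_simplex n" "\<And>i. i < n \<Longrightarrow> t * y i \<le> (\<Sum>j<n. a i j * y j)" for t y
  proof -
    have "t \<le> C" unfolding C_def using that
      by (intro sum_mult_simplex_le[where x = y]) (auto intro: less_imp_le[OF pos])
    then have "(t, y) \<in> K" using that by (auto simp: K_def D_def)
    from p(2)[OF this] show ?thesis by (simp add: r_def)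
  qed
  have "(\<Sum>j<n. a i j * x j) = r * x i" if i: "i < n" for i
  proof (rule ccontr)
    assume neq: "(\<Sum>j<n. a i j * x j) \<noteq> r * x i"
    define y where "y k = (if k < n then \<Sum>j<n. a k j * x j else 0)" for k
    \<comment> \<open>The slack in the inequalities. It is nonnegative, and positive at
      \<open>i\<close>; applying the positive \<open>a\<close> spreads this to all
      coordinates.\<close>
    define z where "z k = y k - r * x k" for k
    have pos_sum: "(\<Sum>j<n. a k j * w j) > 0"
      if "k < n" "\<And>j. j < n \<Longrightarrow> w j \<ge> 0" "l < n" "w l > 0" for k w l
      using that pos by (intro sum_pos2[of _ l]) (auto intro!: mult_nonneg_nonneg less_imp_le[OF pos])
    have x0: "x k \<ge> 0" for k using x by (auto simp: std_simplex_def)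
    obtain l where l: "l < n" "x l > 0"
    proof (rule ccontr)
      assume "\<not> thesis"
      with that x0 have "x l = 0" if "l < n" for l using \<open>l < n\<close> by (metis order_le_less)
      then show False using x by (simp add: std_simplex_def)
    qed
    have ypos: "y k > 0" if "k < n" for k
      using that pos_sum[of k x l] x0 l by (simp add: y_def)
    have z0: "z k \<ge> 0" if "k < n" for k using le that by (simp add: z_def y_def)
    have "z i > 0" using neq z0[OF i] i by (simp add: z_def y_def)
    then have az: "(\<Sum>j<n. a k j * z j) > 0" if "k < n" for k
      using pos_sum[of k z i] z0 i that by simp
    have az_eq: "(\<Sum>j<n. a k j * z j) = (\<Sum>j<n. a k j * y j) - r * y k" if "k < n" for k
      using that by (simp add: z_def y_def right_diff_distrib sum_subtractf sum_distrib_left mult_ac)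
    \<comment> \<open>The largest amount by which \<open>r\<close> can be raised while
      \<open>y\<close> still satisfies all inequalities.\<close>
    define \<delta> where "\<delta> = Min ((\<lambda>k. (\<Sum>j<n. a k j * z j) / y k) ` {..<n})"
    have "\<delta> > 0" unfolding \<delta>_def using n az ypos by (subst Min_gr_iff) auto
    have \<delta>: "\<delta> * y k \<le> (\<Sum>j<n. a k j * z j)" if "k < n" for k
    proof -
      have "\<delta> \<le> (\<Sum>j<n. a k j * z j) / y k" unfolding \<delta>_def using that by (intro Min_le) auto
      then show ?thesis using ypos[OF that] by (simp add: field_simps)
    qed
    define s where "s = (\<Sum>k<n. y k)"
    have s: "s > 0" unfolding s_def using n ypos by (intro sum_pos) auto
    have "(\<lambda>k. y k / s) \<in> std_simplex n"
      using s ypos unfolding std_simplex_def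
      by (auto simp: s_def y_def less_imp_le simp flip: sum_divide_distrib)
    moreover have "(r + \<delta>) * (y k / s) \<le> (\<Sum>j<n. a k j * (y j / s))" if "k < n" for k
    proof -
      have "(r + \<delta>) * y k \<le> (\<Sum>j<n. a k j * y j)"
        using \<delta>[OF that] az_eq[OF that] by (simp add: algebra_simps)
      then have "(r + \<delta>) * y k / s \<le> (\<Sum>j<n. a k j * y j) / s"
        using s by (intro divide_right_mono) auto
      then show ?thesis by (simp add: sum_divide_distrib)
    qed
    ultimately have "r + \<delta> \<le> r" using r \<open>\<delta> > 0\<close> by (intro max) auto
    with \<open>\<delta> > 0\<close> show False by simp
  qed
  with r x show ?thesis by blast
qed

text \<open>The perturbations \<open>a + e\<close> with \<open>0 < e \<le> 1\<close> are positive; the set of all \<open>e\<close> admitting an eigenvector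
  in the simplex is the projection of a compact set, hence contains \<open>0\<close> as well.\<close>

lemma nonneg_eigenvector_exists:
  fixes a :: "nat \<Rightarrow> nat \<Rightarrow> real"
  assumes n: "n > 0" and nonneg: "\<And>i j. i < n \<Longrightarrow> j < n \<Longrightarrow> 0 \<le> a i j"
  shows "\<exists>r. \<exists>x\<in>std_simplex n. \<forall>i<n. (\<Sum>j<n. a i j * x j) = r * x i"
proof -
  \<comment> \<open>A bound on the eigenvalues that is uniform in the perturbation, because
    \<open>e \<le> 1\<close>.\<close>
  define C where "C = (\<Sum>i<n. \<Sum>j<n. a i j + 1)"
  define E where "E = {p :: real \<times> real \<times> (nat \<Rightarrow> real). \<forall>i. i < n \<longrightarrow>
    (\<Sum>j<n. (a i j + fst p) * snd (snd p) j) = fst (snd p) * snd (snd p) i}"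
  define K where "K = ({0..1} \<times> {0..C} \<times> std_simplex n) \<inter> E"
  have "closed E" unfolding E_def
    by (intro closed_Collect_all closed_Collect_imp closed_Collect_eq continuous_intros) auto
  then have "compact K" unfolding K_def
    by (intro compact_Int_closed compact_Times compact_std_simplex) auto
  then have "compact (fst ` K)"
    by (intro compact_continuous_image continuous_intros)
  then have "closed (fst ` K)" by (rule compact_imp_closed)
  moreover have "{0<..<1} \<subseteq> fst ` K"
  proof
    fix e :: real assume e: "e \<in> {0<..<1}"
    have "\<exists>r\<ge>0. \<exists>x\<in>std_simplex n. \<forall>i<n. (\<Sum>j<n. (a i j + e) * x j) = r * x i"
      using n nonneg e by (intro positive_eigenvector_exists) (auto intro: add_nonneg_pos)
    then obtain r x where rx: "r \<ge> 0" "x \<in> std_simplex n"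
      "\<And>i. i < n \<Longrightarrow> (\<Sum>j<n. (a i j + e) * x j) = r * x i" by blast
    have "r \<le> (\<Sum>i<n. \<Sum>j<n. a i j + e)"
      using nonneg e rx by (intro sum_mult_simplex_le[where x = x]) auto
    also have "\<dots> \<le> C" unfolding C_def using e by (intro sum_mono) auto
    finally have "(e, r, x) \<in> K" using rx e by (auto simp: K_def E_def)
    then show "e \<in> fst ` K" by force
  qed
  ultimately have "closure {0<..<1} \<subseteq> fst ` K" by (intro closure_minimal)
  then have "0 \<in> fst ` K" by auto
  then obtain p where "p \<in> K" "fst p = 0" by force
  then show ?thesis
    by (intro exI[of _ "fst (snd p)"] bexI[of _ "snd (snd p)"]) (auto simp: K_def E_def)
qed

lemma spectrum_nonneg_mat_nonempty:
  fixes A :: "real mat"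
  assumes A: "A \<in> carrier_mat n n" and n: "n > 0"
    and nonneg: "\<And>i j. i < n \<Longrightarrow> j < n \<Longrightarrow> 0 \<le> A $$ (i, j)"
  shows "spectrum A \<noteq> {}"
proof -
  obtain r x where x: "x \<in> std_simplex n"
    and eq: "\<And>i. i < n \<Longrightarrow> (\<Sum>j<n. A $$ (i, j) * x j) = r * x i"
    using nonneg_eigenvector_exists[of n "\<lambda>i j. A $$ (i, j)"] n nonneg by blast
  have "vec n x \<noteq> 0\<^sub>v n"
  proof
    assume *: "vec n x = 0\<^sub>v n"
    have "x i = 0" if "i < n" for i using arg_cong[OF *, of "\<lambda>v. v $ i"] that by simp
    then show False using x by (simp add: std_simplex_def)
  qed
  moreover have "A *\<^sub>v vec n x = r \<cdot>\<^sub>v vec n x"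
    using A eq by (intro eq_vecI) (auto simp: scalar_prod_def atLeast0LessThan)
  ultimately have "eigenvector A (vec n x) r" using A by (auto simp: eigenvector_def)
  then show ?thesis by (auto simp: spectrum_def eigenvalue_def)
qed

section \<open>Fekete's lemma in two variables\<close>

text \<open>The remainder \<open>r\<close> starts the induction, and each step splits off one block
  of length \<open>a\<close>.\<close>

lemma subadditive_mult_add_le:
  fixes g :: "nat \<Rightarrow> real"
  assumes sub: "\<And>a b. g (a + b) \<le> g a + g b"
  shows "g (q * a + r) \<le> real q * g a + g r"
proof (induction q)
  case (Suc q)
  have "g (Suc q * a + r) \<le> g a + g (q * a + r)"
    using sub[of a "q * a + r"] by (simp add: add.assoc)
  with Suc show ?case by (simp add: algebra_simps)
qed simp

text \<open>Division with remainder in both variables compares every quotient with that of a fixed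
  block \<open>a\<close> by \<open>b\<close>, up to errors that vanish as \<open>m\<close> and
  \<open>n\<close> grow independently. So the quotients eventually drop below every number above the
  infimum, and they are never below the infimum itself.\<close>

lemma subadditive_div_tendsto_Inf:
  fixes f :: "nat \<Rightarrow> nat \<Rightarrow> real"
  assumes sub1: "\<And>a b n. f (a + b) n \<le> f a n + f b n"
    and sub2: "\<And>m a b. f m (a + b) \<le> f m a + f m b"
    and nonneg: "\<And>m n. 0 \<le> f m n"
  shows "((\<lambda>(m, n). f m n / (real m * real n)) \<longlongrightarrow>
           Inf ((\<lambda>(m, n). f m n / (real m * real n)) ` ({1..} \<times> {1..}))) (at_top \<times>\<^sub>F at_top)"
proof -
  define g where "g = (\<lambda>(m, n). f m n / (real m * real n))"
  define L where "L = Inf (g ` ({1..} \<times> {1..}))"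
  have L: "L \<le> g (m, n)" if "m \<ge> 1" "n \<ge> 1" for m n
    unfolding L_def using that nonneg
    by (intro cInf_lower bdd_belowI2[of _ 0]) (auto simp: g_def)
  \<comment> \<open>The last two terms pay for the remainders of \<open>n\<close> modulo
    \<open>b\<close> and of \<open>m\<close> modulo \<open>a\<close>. Summing over all possible
    remainders makes the numerators independent of \<open>m\<close> and \<open>n\<close>.\<close>
  have bound: "g (m, n) \<le> g (a, b) + (\<Sum>r<b. f a r) / real a / real n + (\<Sum>r<a. f r 1) / real m"
    if "m \<ge> 1" "n \<ge> 1" "a \<ge> 1" "b \<ge> 1" for m n a b
  proof -
    define q r q' r' where "q = m div a" and "r = m mod a" and "q' = n div b" and "r' = n mod b"
    have m: "m = q * a + r" and n: "n = q' * b + r'" and r: "r < a" and r': "r' < b"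
      using that by (simp_all add: q_def r_def q'_def r'_def)
    have q: "real q \<le> real m / real a" and q': "real q' \<le> real n / real b"
      using m n that by (simp_all add: field_simps flip: of_nat_mult of_nat_add)
    have "f m n \<le> q * f a n + f r n"
      unfolding m using sub1 by (intro subadditive_mult_add_le)
    moreover have "f a n \<le> q' * f a b + (\<Sum>r<b. f a r)"
    proof -
      have "f a n \<le> q' * f a b + f a r'"
        unfolding n using sub2 by (intro subadditive_mult_add_le)
      also have "f a r' \<le> (\<Sum>r<b. f a r)"
        using r' nonneg by (intro member_le_sum) auto
      finally show ?thesis by simp
    qed
    moreover have "f r n \<le> n * (\<Sum>r<a. f r 1)"
    proof -
      \<comment> \<open>Here \<open>n\<close> is split into unit blocks with a unit block as
        remainder, so that only \<open>f r 1\<close> occurs.\<close>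
      have "f r ((n - 1) * 1 + 1) \<le> real (n - 1) * f r 1 + f r 1"
        using sub2 by (intro subadditive_mult_add_le)
      then have "f r n \<le> n * f r 1" using that by (simp add: of_nat_diff algebra_simps)
      also have "f r 1 \<le> (\<Sum>r<a. f r 1)"
        using r nonneg by (intro member_le_sum) auto
      finally show ?thesis by (simp add: mult_left_mono)
    qed
    ultimately have "f m n \<le> q * (q' * f a b + (\<Sum>r<b. f a r)) + n * (\<Sum>r<a. f r 1)"
      by (smt (verit) mult_left_mono of_nat_0_le_iff)
    also have "\<dots> \<le> real m / real a * (real n / real b * f a b + (\<Sum>r<b. f a r)) + n * (\<Sum>r<a. f r 1)"
      using q q' nonneg
      by (intro add_right_mono mult_mono add_mono mult_right_mono)
        (auto intro!: add_nonneg_nonneg sum_nonneg)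
    finally have "f m n / (real m * real n) \<le>
        (real m / real a * (real n / real b * f a b + (\<Sum>r<b. f a r)) + n * (\<Sum>r<a. f r 1)) / (real m * real n)"
      by (intro divide_right_mono) auto
    also have "\<dots> = g (a, b) + (\<Sum>r<b. f a r) / real a / real n + (\<Sum>r<a. f r 1) / real m"
      using that by (simp add: g_def field_simps)
    finally show ?thesis by (simp add: g_def)
  qed
  have ev: "\<forall>\<^sub>F p in at_top \<times>\<^sub>F at_top. fst p \<ge> (1::nat) \<and> snd p \<ge> (1::nat)"
    by (auto simp: eventually_prod_sequentially)
  have fst: "filterlim (\<lambda>p. real (fst p)) at_infinity (at_top \<times>\<^sub>F at_top)"
    and snd: "filterlim (\<lambda>p. real (snd p)) at_infinity (at_top \<times>\<^sub>F at_top)"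
    by (intro filterlim_at_top_imp_at_infinity filterlim_compose[OF filterlim_real_sequentially]
        filterlim_fst filterlim_snd)+
  have "(g \<longlongrightarrow> L) (at_top \<times>\<^sub>F at_top)"
  proof (rule order_tendstoI)
    fix l assume "l < L"
    show "\<forall>\<^sub>F p in at_top \<times>\<^sub>F at_top. l < g p"
      using ev by eventually_elim (use L \<open>l < L\<close> in \<open>auto intro: less_le_trans\<close>)
  next
    fix u assume "L < u"
    then obtain a b where ab: "a \<ge> 1" "b \<ge> 1" "g (a, b) < u"
      unfolding L_def using cInf_lessD[of "g ` ({1..} \<times> {1..})" u] by auto
    have "((\<lambda>p. g (a, b) + (\<Sum>r<b. f a r) / real a / real (snd p) + (\<Sum>r<a. f r 1) / real (fst p))
        \<longlongrightarrow> g (a, b) + 0 + 0) (at_top \<times>\<^sub>F at_top)"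
      by (intro tendsto_add tendsto_const tendsto_divide_0[OF tendsto_const] fst snd)
    with ab(3) have "\<forall>\<^sub>F p in at_top \<times>\<^sub>F at_top.
        g (a, b) + (\<Sum>r<b. f a r) / real a / real (snd p) + (\<Sum>r<a. f r 1) / real (fst p) < u"
      by (auto dest: order_tendstoD)
    with ev show "\<forall>\<^sub>F p in at_top \<times>\<^sub>F at_top. g p < u"
    proof eventually_elim
      case (elim p)
      with bound[of "fst p" "snd p" a b] ab(1,2) show ?case by simp
    qed
  qed
  then show ?thesis by (simp add: g_def L_def)
qed

text \<open>The entropy divides by numbers of vertices, whereas subadditivity holds in numbers of
  tiles, which are smaller by one. The factors \<open>(m - 1) / m\<close> and
  \<open>(n - 1) / n\<close> tend to 1, so the limit is the same.\<close>

lemma subadditive_div_Suc_tendsto: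
  fixes f :: "nat \<Rightarrow> nat \<Rightarrow> real"
  assumes sub1: "\<And>a b n. f (a + b) n \<le> f a n + f b n"
    and sub2: "\<And>m a b. f m (a + b) \<le> f m a + f m b"
    and nonneg: "\<And>m n. 0 \<le> f m n"
  shows "((\<lambda>(m, n). f (m - 1) (n - 1) / (real m * real n)) \<longlongrightarrow>
           Inf ((\<lambda>(m, n). f m n / (real m * real n)) ` ({1..} \<times> {1..}))) (at_top \<times>\<^sub>F at_top)"
    (is "(?h \<longlongrightarrow> ?L) ?F")
proof -
  have pred: "filterlim (\<lambda>m::nat. m - 1) at_top at_top"
    by (rule filterlim_minus_const_nat_at_top)
  have *: "filterlim (\<lambda>p. (fst p - 1, snd p - 1)) ?F ?F"
    by (intro filterlim_Pair filterlim_compose[OF pred] filterlim_fst filterlim_snd)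
  have ratio: "(\<lambda>m. real (m - 1) / real m) \<longlonglongrightarrow> 1"
    by (rule LIMSEQ_imp_Suc) (simp add: LIMSEQ_n_over_Suc_n del: of_nat_Suc)
  have "((\<lambda>p. (case (fst p - 1, snd p - 1) of (m, n) \<Rightarrow> f m n / (real m * real n)) *
      (real (fst p - 1) / real (fst p)) * (real (snd p - 1) / real (snd p))) \<longlongrightarrow> ?L * 1 * 1) ?F"
    by (intro tendsto_mult filterlim_compose[OF subadditive_div_tendsto_Inf *]
        filterlim_compose[OF ratio] filterlim_fst filterlim_snd sub1 sub2 nonneg)
  moreover have "\<forall>\<^sub>F p in ?F. (case (fst p - 1, snd p - 1) of (m, n) \<Rightarrow> f m n / (real m * real n)) *
      (real (fst p - 1) / real (fst p)) * (real (snd p - 1) / real (snd p)) = ?h p"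
    \<comment> \<open>From 2 on the shifted sizes are nonzero and cancel.\<close>
    unfolding eventually_prod_sequentially by (intro exI[of _ 2]) (auto simp del: of_nat_diff)
  ultimately show ?thesis by (simp add: tendsto_cong)
qed

section \<open>Cutting and reflecting patterns\<close>

lemma finite_all_tiles: "finite all_tiles"
proof (rule finite_subset)
  define C :: "nat set" where "C = {0, 1}"
  show "all_tiles \<subseteq> (\<lambda>(b, l, t, r). Tile b l t r) ` (C \<times> C \<times> C \<times> C)"
  proof
    fix T assume "T \<in> all_tiles"
    then have "(bot_col T, left_col T, top_col T, right_col T) \<in> C \<times> C \<times> C \<times> C"
      unfolding all_tiles_def C_def[symmetric] by simp
    then show "T \<in> (\<lambda>(b, l, t, r). Tile b l t r) ` (C \<times> C \<times> C \<times> C)"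
      by (rule rev_image_eqI) simp
  qed
  show "finite ((\<lambda>(b, l, t, r). Tile b l t r) ` (C \<times> C \<times> C \<times> C))"
    unfolding C_def by (intro finite_imageI finite_cartesian_product) auto
qed

lemma finite_patterns: "finite B \<Longrightarrow> finite (patterns B m n)"
  unfolding patterns_def by (rule finite_subset[OF _ finite_PiE[of "{..<m - 1} \<times> {..<n - 1}" "\<lambda>_. B"]]) auto

text \<open>A vertical cut splits a pattern into two, which together determine it; the matching
  condition across the cut is lost, hence only an inequality. Sizes are written with
  \<open>Suc\<close> because \<open>Suc a\<close> vertices span \<open>a\<close> tiles.\<close>

lemma num_patterns_add1:
  assumes B: "finite B"
  shows "num_patterns B (Suc (a + b)) (Suc n) \<le> num_patterns B (Suc a) (Suc n) * num_patterns B (Suc b) (Suc n)"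
proof -
  define left where "left T = restrict T ({..<a} \<times> {..<n})" for T :: "nat \<times> nat \<Rightarrow> tile"
  define right where "right T = (\<lambda>(i, j) \<in> {..<b} \<times> {..<n}. T (a + i, j))" for T :: "nat \<times> nat \<Rightarrow> tile"
  have "inj_on (\<lambda>T. (left T, right T)) (patterns B (Suc (a + b)) (Suc n))"
  proof (rule inj_onI)
    fix T T'
    assume T: "T \<in> patterns B (Suc (a + b)) (Suc n)" "T' \<in> patterns B (Suc (a + b)) (Suc n)"
      and "(left T, right T) = (left T', right T')"
    then have eq: "left T p = left T' p" "right T p = right T' p" for p by simp_all
    have "T (i, j) = T' (i, j)" if "i < a + b" "j < n" for i j
    proof (cases "i < a")
      case True
      with that eq(1)[of "(i, j)"] show ?thesis by (simp add: left_def)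
    next
      case False
      with that have "i - a < b" "a + (i - a) = i" by auto
      with that eq(2)[of "(i - a, j)"] show ?thesis by (simp add: right_def)
    qed
    then show "T = T'" using T
      by (intro PiE_ext[of T "{..<a + b} \<times> {..<n}" "\<lambda>_. B" T']) (auto simp: patterns_def)
  qed
  moreover have "(\<lambda>T. (left T, right T)) ` patterns B (Suc (a + b)) (Suc n) \<subseteq>
      patterns B (Suc a) (Suc n) \<times> patterns B (Suc b) (Suc n)"
  proof (rule image_subsetI)
    fix T assume T: "T \<in> patterns B (Suc (a + b)) (Suc n)"
    then have "left T \<in> patterns B (Suc a) (Suc n)"
      by (simp add: patterns_def left_def PiE_iff)
    moreover from T have "right T \<in> patterns B (Suc b) (Suc n)"
      by (simp add: patterns_def right_def PiE_iff)
    ultimately show "(left T, right T) \<in> patterns B (Suc a) (Suc n) \<times> patterns B (Suc b) (Suc n)"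
      by simp
  qed
  ultimately have "card (patterns B (Suc (a + b)) (Suc n)) \<le>
      card (patterns B (Suc a) (Suc n) \<times> patterns B (Suc b) (Suc n))"
    using B by (intro card_inj_on_le) (auto intro: finite_patterns)
  then show ?thesis by (simp add: num_patterns_def card_cartesian_product)
qed

text \<open>Reflection in the main diagonal. The set \<open>B\<close> need not be closed under it,
  so it is always replaced by its image.\<close>

definition tile_transpose :: "tile \<Rightarrow> tile" where
  "tile_transpose T = Tile (left_col T) (bot_col T) (right_col T) (top_col T)"

lemma tile_transpose_simps [simp]:
  "bot_col (tile_transpose T) = left_col T"
  "left_col (tile_transpose T) = bot_col T"
  "top_col (tile_transpose T) = right_col T"
  "right_col (tile_transpose T) = top_col T"
  "tile_transpose (tile_transpose T) = T"
  by (simp_all add: tile_transpose_def)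

lemma tile_transpose_eq_iff [simp]: "tile_transpose T = tile_transpose T' \<longleftrightarrow> T = T'"
  by (metis tile_transpose_simps(5))

lemma tile_transpose_mem_iff: "tile_transpose T \<in> B \<longleftrightarrow> T \<in> tile_transpose ` B"
  by (metis (no_types, lifting) image_iff tile_transpose_simps(5))

text \<open>Reflecting the array together with each of its tiles is a bijection; its inverse is the
  same map with \<open>m\<close> and \<open>n\<close> exchanged.\<close>

lemma num_patterns_transpose: "num_patterns (tile_transpose ` B) n m = num_patterns B m n"
proof -
  define flip where "flip m n T = (\<lambda>(j, i) \<in> {..<n - 1} \<times> {..<m - 1}. tile_transpose (T (i, j)))"
    for m n :: nat and T :: "nat \<times> nat \<Rightarrow> tile"
  have "bij_betw (flip m n) (patterns B m n) (patterns (tile_transpose ` B) n m)"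
  proof (rule bij_betw_byWitness[where f' = "flip n m"])
    show "\<forall>T\<in>patterns B m n. flip n m (flip m n T) = T"
      by (auto simp: patterns_def flip_def PiE_iff extensional_def fun_eq_iff)
    show "\<forall>T\<in>patterns (tile_transpose ` B) n m. flip m n (flip n m T) = T"
      by (auto simp: patterns_def flip_def PiE_iff extensional_def fun_eq_iff)
    show "flip m n ` patterns B m n \<subseteq> patterns (tile_transpose ` B) n m"
      by (auto simp: patterns_def flip_def PiE_iff)
    show "flip n m ` patterns (tile_transpose ` B) n m \<subseteq> patterns B m n"
      by (auto simp: patterns_def flip_def PiE_iff tile_transpose_mem_iff)
  qed
  then show ?thesis by (simp add: num_patterns_def bij_betw_same_card)
qed

lemma num_patterns_add2:
  assumes "finite B"
  shows "num_patterns B (Suc m) (Suc (a + b)) \<le> num_patterns B (Suc m) (Suc a) * num_patterns B (Suc m) (Suc b)"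
  using num_patterns_add1[of "tile_transpose ` B" a b m] assms by (simp add: num_patterns_transpose)

text \<open>A column read from bottom to top becomes a row read from left to right. Since
  \<open>m \<ge> 1\<close>, the lists are nonempty and \<open>hd\<close> and \<open>last\<close>
  commute with the reflection.\<close>

lemma S_mat_transpose:
  assumes "m \<ge> 1"
  shows "S_mat (tile_transpose ` B) m \<alpha> = W_mat B m \<alpha>"
proof -
  have "card {Ts. length Ts = m \<and> set Ts \<subseteq> tile_transpose ` B \<and>
       (\<forall>i. i + 1 < m \<longrightarrow> right_col (Ts ! i) = left_col (Ts ! (i + 1))) \<and>
       psi [left_col (hd Ts), right_col (last Ts)] = \<alpha> \<and>
       psi (map bot_col Ts) = k + 1 \<and> psi (map top_col Ts) = l + 1} =
     card {Ts. length Ts = m \<and> set Ts \<subseteq> B \<and>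
       (\<forall>i. i + 1 < m \<longrightarrow> top_col (Ts ! i) = bot_col (Ts ! (i + 1))) \<and>
       psi [bot_col (hd Ts), top_col (last Ts)] = \<alpha> \<and>
       psi (map left_col Ts) = k + 1 \<and> psi (map right_col Ts) = l + 1}"
    (is "card ?S = card ?W") for k l
  proof -
    have *: "(map tile_transpose Ts \<in> ?S) = (Ts \<in> ?W)" for Ts
    proof (cases "length Ts = m")
      case True
      then have "Ts \<noteq> []" using assms by auto
      moreover have "map c (map tile_transpose Ts) = map c' Ts" if "\<And>T. c (tile_transpose T) = c' T"
        for c c' :: "tile \<Rightarrow> nat" using that by simp
      note this[of bot_col left_col] this[of top_col right_col]
      moreover have "set (map tile_transpose Ts) \<subseteq> tile_transpose ` B \<longleftrightarrow> set Ts \<subseteq> B"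
        by (auto simp: image_iff)
      ultimately show ?thesis using True
        by (simp add: hd_map last_map del: map_map)
    qed simp
    have "Ts \<in> map tile_transpose ` ?W" if "Ts \<in> ?S" for Ts
    proof -
      have eq: "Ts = map tile_transpose (map tile_transpose Ts)"
        by (simp add: map_idI)
      with that have "map tile_transpose Ts \<in> ?W" using *[of "map tile_transpose Ts"] by metis
      with eq show ?thesis by (rule image_eqI)
    qed
    with * have "?S = map tile_transpose ` ?W" by blast
    moreover have "inj_on (map tile_transpose) ?W"
      by (rule inj_onI) (auto dest: map_injective simp: inj_def)
    ultimately show ?thesis by (simp add: card_image)
  qed
  then show ?thesis by (simp add: S_mat_def W_mat_def)
qed

section \<open>The counting function as a binary expansion\<close>

lemma psi_Cons: "psi (x # u) = x * 2 ^ length u + psi u"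
  by (simp add: psi_def sum.lessThan_Suc_shift del: sum.lessThan_Suc)

lemma psi_bounds:
  assumes "set u \<subseteq> {0, 1}"
  shows "1 \<le> psi u \<and> psi u \<le> 2 ^ length u"
  using assms
proof (induction u)
  case (Cons x u)
  then show ?case by (auto simp: psi_Cons)
qed (simp add: psi_def)

lemma psi_inject:
  assumes "length u = length v" "set u \<subseteq> {0, 1}" "set v \<subseteq> {0, 1}" "psi u = psi v"
  shows "u = v"
  using assms
proof (induction u v rule: list_induct2)
  case (Cons x u y v)
  \<comment> \<open>The tails have codes in an interval of \<open>2 ^ length u\<close> consecutive
    numbers, so different leading digits give different codes.\<close>
  have "psi u \<in> {1..2 ^ length u}" "psi v \<in> {1..2 ^ length u}"
    using psi_bounds[of u] psi_bounds[of v] Cons.prems Cons.hyps by auto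
  with Cons.prems Cons.hyps have "x = y" by (auto simp: psi_Cons)
  with Cons show ?case by (auto simp: psi_Cons)
qed simp

text \<open>The code 1 stands for the colors 0, 0 and the code 4 for 1, 1, so all four colors agree.
  The conclusion is what the seam between two different strips requires.\<close>

lemma psi_pair_eq:
  assumes "psi [c, d] = \<alpha>" "psi [c', d'] = \<alpha>" "\<alpha> \<in> {1, 4}" "{c, d, c', d'} \<subseteq> {0, 1}"
  shows "c = d'"
proof -
  have "psi [a, b] = 1 + 2 * a + b" for a b by (simp add: psi_Cons) (simp add: psi_def)
  with assms show ?thesis by auto
qed

lemma colors_all_tiles:
  assumes "B \<subseteq> all_tiles" "T \<in> B"
  shows "{bot_col T, left_col T, top_col T, right_col T} \<subseteq> {0, 1}"
  using assms by (auto simp: all_tiles_def)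

lemma colors_set:
  assumes "B \<subseteq> all_tiles" "set R \<subseteq> B"
  shows "set (map bot_col R) \<subseteq> {0, 1}" "set (map top_col R) \<subseteq> {0, 1}"
proof -
  have "set R \<subseteq> all_tiles" using assms by auto
  then show "set (map bot_col R) \<subseteq> {0, 1}" "set (map top_col R) \<subseteq> {0, 1}"
    by (force simp: all_tiles_def)+
qed

section \<open>Counting strips by products of connecting operators\<close>

text \<open>Row \<open>k\<close> of \<open>S_mat B m \<alpha>\<close> counts these rows of tiles,
  sorted by their top word, which is left free here.\<close>

definition tile_rows :: "tile set \<Rightarrow> nat \<Rightarrow> nat \<Rightarrow> nat \<Rightarrow> tile list set" where
  "tile_rows B m \<alpha> k = {Ts. length Ts = m \<and> set Ts \<subseteq> B \<and>
     (\<forall>i. i + 1 < m \<longrightarrow> right_col (Ts ! i) = left_col (Ts ! (i + 1))) \<and>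
     psi [left_col (hd Ts), right_col (last Ts)] = \<alpha> \<and> psi (map bot_col Ts) = k + 1}"

text \<open>Rows are listed from bottom to top. The top word of a row, as a zero-based index,
  prescribes the bottom word of the next; the top word of the last row is free, which corresponds to
  row sums of the matrix product.\<close>

fun strips :: "tile set \<Rightarrow> nat \<Rightarrow> nat list \<Rightarrow> nat \<Rightarrow> tile list list set" where
  "strips B m [] k = {[]}"
| "strips B m (\<alpha> # \<gamma>) k =
     {R # Rs |R Rs. R \<in> tile_rows B m \<alpha> k \<and> Rs \<in> strips B m \<gamma> (psi (map top_col R) - 1)}"

lemma S_mat_carrier [simp]: "S_mat B m \<alpha> \<in> carrier_mat (2 ^ m) (2 ^ m)"
  by (simp add: S_mat_def)

lemma S_mat_index:
  assumes "k < 2 ^ m" "l < 2 ^ m"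
  shows "S_mat B m \<alpha> $$ (k, l) = real (card {R \<in> tile_rows B m \<alpha> k. psi (map top_col R) = l + 1})"
  using assms by (simp add: S_mat_def tile_rows_def conj_assoc)

lemma finite_tile_rows: "finite B \<Longrightarrow> finite (tile_rows B m \<alpha> k)"
  by (rule finite_subset[OF _ finite_lists_length_eq[of B m]]) (auto simp: tile_rows_def)

text \<open>Sorts the strips by the top word of the lowest row. As all colors are 0 or 1, its index
  is below \<open>2 ^ m\<close>.\<close>

lemma strips_Cons_UN:
  assumes B: "B \<subseteq> all_tiles"
  shows "strips B m (\<alpha> # \<gamma>) k = (\<Union>l<2 ^ m.
    (\<lambda>(R, Rs). R # Rs) ` ({R \<in> tile_rows B m \<alpha> k. psi (map top_col R) = l + 1} \<times> strips B m \<gamma> l))"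
    (is "_ = ?U")
proof (intro equalityI subsetI)
  fix Q assume "Q \<in> strips B m (\<alpha> # \<gamma>) k"
  then obtain R Rs where Q: "Q = R # Rs" "R \<in> tile_rows B m \<alpha> k" "Rs \<in> strips B m \<gamma> (psi (map top_col R) - 1)"
    by auto
  have "set (map top_col R) \<subseteq> {0, 1}" "length R = m"
    using Q(2) colors_set[OF B, of R] by (auto simp: tile_rows_def)
  from psi_bounds[OF this(1)] this(2)
  have "psi (map top_col R) - 1 < 2 ^ m" "psi (map top_col R) = psi (map top_col R) - 1 + 1" by auto
  with Q show "Q \<in> ?U" by blast
next
  fix Q assume "Q \<in> ?U"
  then show "Q \<in> strips B m (\<alpha> # \<gamma>) k" by auto
qed

lemma finite_strips:
  assumes B: "B \<subseteq> all_tiles" "finite B"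
  shows "finite (strips B m \<gamma> k)"
proof (induction \<gamma> arbitrary: k)
  case (Cons \<alpha> \<gamma>)
  then show ?case unfolding strips_Cons_UN[OF B(1)] using finite_tile_rows[OF B(2)] by auto
qed simp

lemma card_strips_Cons:
  assumes B: "B \<subseteq> all_tiles" "finite B" and k: "k < 2 ^ m"
  shows "real (card (strips B m (\<alpha> # \<gamma>) k)) =
           (\<Sum>l<2 ^ m. S_mat B m \<alpha> $$ (k, l) * real (card (strips B m \<gamma> l)))"
proof -
  define D where "D l = (\<lambda>(R, Rs). R # Rs) `
    ({R \<in> tile_rows B m \<alpha> k. psi (map top_col R) = l + 1} \<times> strips B m \<gamma> l)" for l
  have D: "finite (D l)" for l
    unfolding D_def using finite_tile_rows finite_strips B by auto
  have card_D: "card (D l) = card {R \<in> tile_rows B m \<alpha> k. psi (map top_col R) = l + 1} * card (strips B m \<gamma> l)" for l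
    unfolding D_def by (subst card_image) (auto simp: inj_on_def card_cartesian_product)
  have "card (strips B m (\<alpha> # \<gamma>) k) = (\<Sum>l<2 ^ m. card (D l))"
    unfolding strips_Cons_UN[OF B(1)] D_def[symmetric]
    using D by (intro card_UN_disjoint) (auto simp: D_def)
  then show ?thesis
    using k by (simp add: card_D S_mat_index)
qed

lemma mat_prod_carrier:
  assumes "\<And>A. A \<in> set As \<Longrightarrow> A \<in> carrier_mat d d"
  shows "mat_prod d As \<in> carrier_mat d d"
  using assms by (induction As) (auto simp: mat_prod_def intro: mult_carrier_mat)

lemma mult_mat_index:
  fixes A C :: "'a :: semiring_0 mat"
  assumes "A \<in> carrier_mat d d" "C \<in> carrier_mat d d" "i < d" "j < d"
  shows "(A * C) $$ (i, j) = (\<Sum>l<d. A $$ (i, l) * C $$ (l, j))"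
  using assms by (simp add: scalar_prod_def atLeast0LessThan)

lemma mat_prod_Cons: "mat_prod d (A # As) = A * mat_prod d As"
  by (simp add: mat_prod_def)

lemma mat_prod_nonneg:
  fixes As :: "real mat list"
  assumes "\<And>A. A \<in> set As \<Longrightarrow> A \<in> carrier_mat d d"
    and "\<And>A i j. A \<in> set As \<Longrightarrow> i < d \<Longrightarrow> j < d \<Longrightarrow> 0 \<le> A $$ (i, j)"
    and "i < d" "j < d"
  shows "0 \<le> mat_prod d As $$ (i, j)"
  using assms
proof (induction As arbitrary: i)
  case Nil
  then show ?case by (simp add: mat_prod_def)
next
  case (Cons A As)
  have "mat_prod d As \<in> carrier_mat d d" using Cons.prems by (intro mat_prod_carrier) auto
  moreover have "A \<in> carrier_mat d d" using Cons.prems by auto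
  ultimately show ?case using Cons
    by (auto simp: mat_prod_Cons mult_mat_index[of _ d] intro!: sum_nonneg mult_nonneg_nonneg)
qed

text \<open>Iterates the transfer matrix step. The upper part \<open>\<gamma>\<close> is arbitrary
  so that further copies of \<open>\<beta>\<close> can be added one at a time.\<close>

lemma card_strips_append:
  assumes B: "B \<subseteq> all_tiles" "finite B" and k: "k < 2 ^ m"
  shows "real (card (strips B m (\<beta> @ \<gamma>) k)) =
    (\<Sum>l<2 ^ m. mat_prod (2 ^ m) (map (S_mat B m) \<beta>) $$ (k, l) * real (card (strips B m \<gamma> l)))"
  using k
proof (induction \<beta> arbitrary: k)
  case Nil
  have "(\<Sum>l<2 ^ m. 1\<^sub>m (2 ^ m) $$ (k, l) * real (card (strips B m \<gamma> l))) =
      (\<Sum>l<2 ^ m. if l = k then real (card (strips B m \<gamma> l)) else 0)"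
    using Nil by (intro sum.cong) auto
  with Nil show ?case by (simp add: mat_prod_def sum.delta)
next
  case (Cons \<alpha> \<beta>)
  define P where "P = mat_prod (2 ^ m) (map (S_mat B m) \<beta>)"
  define N where "N l = real (card (strips B m \<gamma> l))" for l
  have P: "P \<in> carrier_mat (2 ^ m) (2 ^ m)" unfolding P_def by (intro mat_prod_carrier) auto
  have "real (card (strips B m ((\<alpha> # \<beta>) @ \<gamma>) k)) =
      (\<Sum>l<2 ^ m. S_mat B m \<alpha> $$ (k, l) * (\<Sum>j<2 ^ m. P $$ (l, j) * N j))"
    using Cons by (simp only: append_Cons card_strips_Cons[OF B Cons.prems])
      (auto simp: P_def N_def intro!: sum.cong)
  also have "\<dots> = (\<Sum>j<2 ^ m. (\<Sum>l<2 ^ m. S_mat B m \<alpha> $$ (k, l) * P $$ (l, j)) * N j)"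
    by (subst sum_distrib_left, subst sum.swap) (simp add: sum_distrib_right mult.assoc)
  also have "\<dots> = (\<Sum>j<2 ^ m. (S_mat B m \<alpha> * P) $$ (k, j) * N j)"
    using Cons.prems P by (intro sum.cong) (auto simp: mult_mat_index[of _ "2 ^ m"])
  finally show ?case by (simp add: P_def N_def mat_prod_Cons)
qed

text \<open>An eigenvector may have mixed signs, but its absolute values satisfy \<open>r * \<bar>x
  i\<bar> \<le> (\<Sum>j<2 ^ m. P $$ (i, j) * \<bar>x j\<bar>)\<close> because \<open>P\<close> is
  nonnegative. Iterating this and bounding all absolute values by the largest one produces the strip
  counts.\<close>

lemma eigenvalue_power_le_card_strips:
  assumes B: "B \<subseteq> all_tiles" "finite B"
    and r: "eigenvalue (mat_prod (2 ^ m) (map (S_mat B m) \<beta>)) r" "r > 0"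
  shows "\<exists>k<2 ^ m. r ^ q \<le> real (card (strips B m (concat (replicate q \<beta>)) k))"
proof -
  define P where "P = mat_prod (2 ^ m) (map (S_mat B m) \<beta>)"
  have P: "P \<in> carrier_mat (2 ^ m) (2 ^ m)" unfolding P_def by (intro mat_prod_carrier) auto
  have P0: "0 \<le> P $$ (i, j)" if "i < 2 ^ m" "j < 2 ^ m" for i j
    unfolding P_def using that by (intro mat_prod_nonneg) (auto simp: S_mat_def)
  obtain v where v: "v \<in> carrier_vec (2 ^ m)" "v \<noteq> 0\<^sub>v (2 ^ m)" "P *\<^sub>v v = r \<cdot>\<^sub>v v"
    using r(1) P unfolding eigenvalue_def eigenvector_def P_def[symmetric] by auto
  define x where "x i = vec_index v i" for i
  have eq: "r * x i = (\<Sum>j<2 ^ m. P $$ (i, j) * x j)" if "i < 2 ^ m" for i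
  proof -
    have "vec_index (P *\<^sub>v v) i = vec_index (r \<cdot>\<^sub>v v) i" using v(3) by simp
    then show ?thesis using that P v(1)
      by (simp add: x_def scalar_prod_def atLeast0LessThan)
  qed
  \<comment> \<open>The eigenvector is largest in absolute value at \<open>k\<close>; there the
    final inequality can be divided by \<open>\<bar>x k\<bar>\<close>.\<close>
  obtain k where k: "k < 2 ^ m" "\<And>j. j < 2 ^ m \<Longrightarrow> \<bar>x j\<bar> \<le> \<bar>x k\<bar>"
  proof -
    have "Max ((\<lambda>j. \<bar>x j\<bar>) ` {..<2 ^ m}) \<in> (\<lambda>j. \<bar>x j\<bar>) ` {..<2 ^ m}"
      by (intro Max_in) (auto simp: lessThan_empty_iff)
    then obtain k where "k < 2 ^ m" "Max ((\<lambda>j. \<bar>x j\<bar>) ` {..<2 ^ m}) = \<bar>x k\<bar>" by auto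
    then show thesis by (intro that[of k]) (auto simp flip: \<open>Max _ = _\<close>)
  qed
  have xk: "\<bar>x k\<bar> > 0"
  proof (rule ccontr)
    assume "\<not> \<bar>x k\<bar> > 0"
    then have "x j = 0" if "j < 2 ^ m" for j using k(2)[OF that] by simp
    then have "v = 0\<^sub>v (2 ^ m)" using v(1) by (intro eq_vecI) (auto simp: x_def)
    with v(2) show False by simp
  qed
  \<comment> \<open>Stated for all \<open>i\<close>, since each application of \<open>P\<close>
    mixes the coordinates.\<close>
  have "r ^ q * \<bar>x i\<bar> \<le> real (card (strips B m (concat (replicate q \<beta>)) i)) * \<bar>x k\<bar>" if "i < 2 ^ m" for i
    using that
  proof (induction q arbitrary: i)
    case 0
    then show ?case using k(2) by simp
  next
    case (Suc q)
    define N where "N = (\<lambda>j. real (card (strips B m (concat (replicate q \<beta>)) j)))"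
    have "r ^ Suc q * \<bar>x i\<bar> = r ^ q * \<bar>\<Sum>j<2 ^ m. P $$ (i, j) * x j\<bar>"
      using r(2) Suc.prems by (simp add: abs_mult flip: eq)
    also have "\<dots> \<le> r ^ q * (\<Sum>j<2 ^ m. P $$ (i, j) * \<bar>x j\<bar>)"
      using r(2) Suc.prems P0
      by (intro mult_left_mono order_trans[OF sum_abs] sum_mono) (auto simp: abs_mult)
    also have "\<dots> = (\<Sum>j<2 ^ m. P $$ (i, j) * (r ^ q * \<bar>x j\<bar>))"
      by (simp add: sum_distrib_left mult_ac)
    also have "\<dots> \<le> (\<Sum>j<2 ^ m. P $$ (i, j) * (N j * \<bar>x k\<bar>))"
      using Suc P0 by (intro sum_mono mult_left_mono) (auto simp: N_def)
    also have "\<dots> = real (card (strips B m (concat (replicate (Suc q) \<beta>)) i)) * \<bar>x k\<bar>"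
      using card_strips_append[OF B Suc.prems, of \<beta> "concat (replicate q \<beta>)"]
      by (simp add: P_def N_def sum_distrib_right mult.assoc)
    finally show ?case .
  qed
  from this[OF k(1)] xk k(1) show ?thesis by auto
qed

section \<open>Gluing strips into patterns\<close>

text \<open>Passes from the recursion, which compares codes of words, to positions in the array;
  injectivity of \<open>psi\<close> turns equal codes into equal colors.\<close>

lemma strips_nth:
  assumes B: "B \<subseteq> all_tiles" and Rs: "Rs \<in> strips B m \<gamma> k"
  shows "length Rs = length \<gamma>"
    and "j < length \<gamma> \<Longrightarrow> \<exists>l. Rs ! j \<in> tile_rows B m (\<gamma> ! j) l"
    and "Suc j < length \<gamma> \<Longrightarrow> map top_col (Rs ! j) = map bot_col (Rs ! Suc j)"
proof -
  \<comment> \<open>The last conjunct serves the induction: it links a new lowest row to the row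
    above it.\<close>
  have "length Rs = length \<gamma> \<and> (\<forall>j<length \<gamma>. \<exists>l. Rs ! j \<in> tile_rows B m (\<gamma> ! j) l) \<and>
     (\<forall>j. Suc j < length \<gamma> \<longrightarrow> map top_col (Rs ! j) = map bot_col (Rs ! Suc j)) \<and>
     (\<gamma> \<noteq> [] \<longrightarrow> psi (map bot_col (Rs ! 0)) = k + 1)"
    using Rs
  proof (induction \<gamma> arbitrary: Rs k)
    case (Cons \<alpha> \<gamma>)
    then obtain R Rs' where eq: "Rs = R # Rs'" and R: "R \<in> tile_rows B m \<alpha> k"
      and Rs': "Rs' \<in> strips B m \<gamma> (psi (map top_col R) - 1)" by auto
    note IH = Cons.IH[OF Rs']
    have R_top: "set (map top_col R) \<subseteq> {0, 1}" using R by (intro colors_set[OF B]) (auto simp: tile_rows_def)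
    have "map top_col R = map bot_col (Rs' ! 0)" if "\<gamma> \<noteq> []"
    proof (rule psi_inject)
      have "0 < length \<gamma>" using that by simp
      with IH obtain l where l: "Rs' ! 0 \<in> tile_rows B m (\<gamma> ! 0) l" by blast
      then show "length (map top_col R) = length (map bot_col (Rs' ! 0))"
        using R by (simp add: tile_rows_def)
      show "set (map bot_col (Rs' ! 0)) \<subseteq> {0, 1}"
        using l by (intro colors_set[OF B]) (auto simp: tile_rows_def)
      \<comment> \<open>As \<open>psi\<close> is at least 1, shifting to zero-based indices and back
        changes nothing.\<close>
      show "psi (map top_col R) = psi (map bot_col (Rs' ! 0))"
        using IH that psi_bounds[OF R_top] by auto
    qed (rule R_top)
    with IH R show ?case unfolding eq
      by (auto simp: nth_Cons less_Suc_eq_0_disj tile_rows_def split: nat.split)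
  qed simp
  then show "length Rs = length \<gamma>"
    and "j < length \<gamma> \<Longrightarrow> \<exists>l. Rs ! j \<in> tile_rows B m (\<gamma> ! j) l"
    and "Suc j < length \<gamma> \<Longrightarrow> map top_col (Rs ! j) = map bot_col (Rs ! Suc j)" by auto
qed

text \<open>As \<open>psi [c, d] \<in> {1, 4}\<close> forces \<open>c = d\<close>, strips with the same \<open>\<gamma>\<close> fit side by side in any order.\<close>

lemma card_strips_power_le:
  assumes B: "B \<subseteq> all_tiles" "finite B" and m: "m \<ge> 1" and \<gamma>: "set \<gamma> \<subseteq> {1, 4}"
  shows "card (strips B m \<gamma> k) ^ p \<le> num_patterns B (Suc (p * m)) (Suc (length \<gamma>))"
proof -
  define X where "X = strips B m \<gamma> k"
  \<comment> \<open>Column \<open>i\<close> of the pattern lies in the strip with number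
    \<open>i div m\<close>, at position \<open>i mod m\<close> of each of its rows.\<close>
  define glue where "glue F = (\<lambda>(i, j) \<in> {..<p * m} \<times> {..<length \<gamma>}. F (i div m) ! j ! (i mod m))"
    for F :: "nat \<Rightarrow> tile list list"
  have block: "i div m < p" "i mod m < m" if "i < p * m" for i
    using that m by (auto simp: less_mult_imp_div_less)
  have X_nth: "length Q = length \<gamma>" "j < length \<gamma> \<Longrightarrow> length (Q ! j) = m"
      "j < length \<gamma> \<Longrightarrow> i < m \<Longrightarrow> Q ! j ! i \<in> B"
      "j < length \<gamma> \<Longrightarrow> Suc i < m \<Longrightarrow> right_col (Q ! j ! i) = left_col (Q ! j ! Suc i)"
      "j < length \<gamma> \<Longrightarrow> psi [left_col (Q ! j ! 0), right_col (Q ! j ! (m - 1))] = \<gamma> ! j"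
      "Suc j < length \<gamma> \<Longrightarrow> i < m \<Longrightarrow> top_col (Q ! j ! i) = bot_col (Q ! Suc j ! i)"
    if "Q \<in> X" for Q i j
  proof -
    note * = strips_nth[OF B(1) that[unfolded X_def]]
    show "length Q = length \<gamma>" by (rule *)
    show len: "length (Q ! j) = m" if "j < length \<gamma>" for j
      using *(2)[OF that] by (auto simp: tile_rows_def)
    show "j < length \<gamma> \<Longrightarrow> i < m \<Longrightarrow> Q ! j ! i \<in> B"
      using *(2)[of j] by (auto simp: tile_rows_def)
    show "j < length \<gamma> \<Longrightarrow> Suc i < m \<Longrightarrow> right_col (Q ! j ! i) = left_col (Q ! j ! Suc i)"
      using *(2)[of j] by (auto simp: tile_rows_def)
    show "psi [left_col (Q ! j ! 0), right_col (Q ! j ! (m - 1))] = \<gamma> ! j" if j: "j < length \<gamma>"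
    proof -
      have "Q ! j \<noteq> []" using len[OF j] m by auto
      then show ?thesis using *(2)[OF j] by (auto simp: tile_rows_def hd_conv_nth last_conv_nth)
    qed
    show "top_col (Q ! j ! i) = bot_col (Q ! Suc j ! i)" if "Suc j < length \<gamma>" "i < m"
      using *(3)[OF that(1)] len[of j] len[of "Suc j"] that by (metis Suc_lessD nth_map)
  qed
  have edge: "left_col (Q ! j ! 0) = right_col (Q' ! j ! (m - 1))"
    if "Q \<in> X" "Q' \<in> X" "j < length \<gamma>" for Q Q' j
  proof -
    have \<gamma>_j: "\<gamma> ! j \<in> {1, 4}" using \<gamma> nth_mem[OF that(3)] by blast
    have color: "left_col (R ! j ! i) \<in> {0, 1} \<and> right_col (R ! j ! i) \<in> {0, 1}"
      if "R \<in> X" "i < m" for R i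
    proof -
      have "R ! j ! i \<in> B" using that \<open>j < length \<gamma>\<close> by (intro X_nth(3))
      from colors_all_tiles[OF B(1) this] show ?thesis by simp
    qed
    have "0 < m" "m - 1 < m" using m by auto
    then have "{left_col (Q ! j ! 0), right_col (Q ! j ! (m - 1)), left_col (Q' ! j ! 0),
        right_col (Q' ! j ! (m - 1))} \<subseteq> {0, 1}"
      using color that(1,2) by (intro insert_subsetI empty_subsetI) blast+
    with \<gamma>_j show ?thesis
      by (rule psi_pair_eq[OF X_nth(5)[OF that(1,3)] X_nth(5)[OF that(2,3)]])
  qed
  have "inj_on glue (PiE {..<p} (\<lambda>_. X))"
  proof (rule inj_onI, rule PiE_ext)
    fix F F' i
    assume F: "F \<in> PiE {..<p} (\<lambda>_. X)" "F' \<in> PiE {..<p} (\<lambda>_. X)" and eq: "glue F = glue F'"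
    assume i: "i \<in> {..<p}"
    then have X: "F i \<in> X" "F' i \<in> X" using F by auto
    have "F i ! j ! l = F' i ! j ! l" if "j < length \<gamma>" "l < m" for j l
    proof -
      have "i * m + l < p * m"
        using i that mult_le_mono1[of "Suc i" p m] by simp
      then show ?thesis
        using fun_cong[OF eq, of "(i * m + l, j)"] that by (simp add: glue_def)
    qed
    then show "F i = F' i"
      using X_nth(1,2)[OF X(1)] X_nth(1,2)[OF X(2)] by (intro nth_equalityI) auto
  qed
  moreover have "glue ` PiE {..<p} (\<lambda>_. X) \<subseteq> patterns B (Suc (p * m)) (Suc (length \<gamma>))"
  proof (rule image_subsetI)
    fix F assume F: "F \<in> PiE {..<p} (\<lambda>_. X)"
    have FX: "F (i div m) \<in> X" if "i < p * m" for i using F block[OF that] by auto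
    have "right_col (glue F (i, j)) = left_col (glue F (Suc i, j))"
      if "Suc i < p * m" "j < length \<gamma>" for i j
    \<comment> \<open>Either the edge is a seam between two consecutive strips, or it lies inside
      one row of a single strip.\<close>
    proof (cases "Suc (i mod m) = m")
      case True
      then have "Suc i mod m = 0" "i mod m = m - 1" by (auto simp: mod_Suc)
      then show ?thesis
        using edge[OF FX[of "Suc i"] FX[of i]] that by (simp add: glue_def)
    next
      case False
      have "Suc (i mod m) < m" using False m mod_less_divisor[of m i] by linarith
      moreover from False have "Suc i mod m = Suc (i mod m)" "Suc i div m = i div m"
        by (auto simp: mod_Suc div_Suc)
      ultimately show ?thesis
        using X_nth(4)[OF FX[of i], of j "i mod m"] that by (simp add: glue_def)
    qed
    moreover have "top_col (glue F (i, j)) = bot_col (glue F (i, Suc j))"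
      if "i < p * m" "Suc j < length \<gamma>" for i j
      using X_nth(6)[OF FX[of i], of j "i mod m"] block that by (simp add: glue_def)
    moreover have "glue F \<in> {..<p * m} \<times> {..<length \<gamma>} \<rightarrow>\<^sub>E B"
      using X_nth(3)[OF FX] block by (auto simp: glue_def)
    ultimately show "glue F \<in> patterns B (Suc (p * m)) (Suc (length \<gamma>))"
      by (simp add: patterns_def)
  qed
  moreover have "finite (patterns B (Suc (p * m)) (Suc (length \<gamma>)))"
    using B by (intro finite_patterns)
  ultimately have "card (PiE {..<p} (\<lambda>_. X)) \<le> num_patterns B (Suc (p * m)) (Suc (length \<gamma>))"
    unfolding num_patterns_def by (rule card_inj_on_le)
  then show ?thesis by (simp add: card_PiE X_def)
qed

section \<open>Lower bounds for the entropy\<close>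

text \<open>A positive number bounded by a product of counts has positive factors. This carries
  positivity from multiples of the block size to all sizes.\<close>

lemma num_patterns_pos_antimono:
  assumes B: "finite B" and pos: "num_patterns B (Suc (a + a')) (Suc (b + b')) > 0"
  shows "num_patterns B (Suc a) (Suc b) > 0"
proof -
  from pos num_patterns_add1[OF B, of a a' "b + b'"]
  have "num_patterns B (Suc a) (Suc (b + b')) > 0"
    by (metis gr_zeroI le_zero_eq mult_is_0 not_gr_zero)
  with num_patterns_add2[OF B, of a b b'] show ?thesis
    by (metis gr_zeroI le_zero_eq mult_is_0 not_gr_zero)
qed

lemma ln_of_nat_le_add:
  assumes "a \<le> b * c" "a > 0"
  shows "ln (real a) \<le> ln (real b) + ln (real c)"
proof -
  have "b > 0" "c > 0" using assms by (auto intro: gr0I)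
  moreover have "ln (real a) \<le> ln (real (b * c))"
    using assms by (intro ln_mono) (auto simp flip: of_nat_mult)
  ultimately show ?thesis by (simp add: ln_mult)
qed

text \<open>The hypothesis concerns multiples of \<open>m\<close> and \<open>k\<close> only. Cutting
  \<open>a * m\<close> by \<open>b * k\<close> tiles into \<open>m * k\<close> blocks of
  \<open>a\<close> by \<open>b\<close> tiles transfers it to every quotient, hence to their infimum,
  which is the entropy.\<close>

lemma le_entropy:
  assumes B: "finite B" and m: "m \<ge> 1" and k: "k \<ge> 1" and r: "r > 0"
    and bound: "\<And>p q. r ^ (p * q) \<le> real (num_patterns B (Suc (p * m)) (Suc (q * k)))"
  shows "ln r / (real m * real k) \<le> entropy B"
proof -
  define f where "f a b = ln (real (num_patterns B (Suc a) (Suc b)))" for a b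
  \<comment> \<open>Excludes the exceptional case in the definition of the entropy and makes all
    logarithms nonnegative.\<close>
  have pos: "num_patterns B (Suc a) (Suc b) > 0" for a b
  proof -
    have "real (num_patterns B (Suc (a * m)) (Suc (b * k))) > 0"
      using bound[of a b] r by (meson less_le_trans zero_less_power)
    moreover have "a * m = a + a * (m - 1)" "b * k = b + b * (k - 1)"
      using m k by (simp_all add: algebra_simps)
    ultimately show ?thesis
      using num_patterns_pos_antimono[OF B, of a "a * (m - 1)" b "b * (k - 1)"] by simp
  qed
  have nonneg: "0 \<le> f a b" for a b
    using pos[of a b] by (simp add: f_def)
  have sub1: "f (a + b) n \<le> f a n + f b n" for a b n
    unfolding f_def by (intro ln_of_nat_le_add num_patterns_add1 B pos)
  have sub2: "f n (a + b) \<le> f n a + f n b" for a b n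
    unfolding f_def by (intro ln_of_nat_le_add num_patterns_add2 B pos)
  define L where "L = Inf ((\<lambda>(a, b). f a b / (real a * real b)) ` ({1..} \<times> {1..}))"
  have "ln r / (real m * real k) \<le> L"
    unfolding L_def
  proof (rule cInf_greatest)
    fix y assume "y \<in> (\<lambda>(a, b). f a b / (real a * real b)) ` ({1..} \<times> {1..})"
    then obtain a b where ab: "a \<ge> 1" "b \<ge> 1" and y: "y = f a b / (real a * real b)" by auto
    have "real (a * b) * ln r = ln (r ^ (a * b))" using r by (simp add: ln_realpow)
    also have "\<dots> \<le> f (a * m) (b * k)"
      unfolding f_def using bound[of a b] r by (intro ln_mono) auto
    also have "\<dots> = f ((m - 1) * a + a) (b * k)"
      using m by (simp add: algebra_simps)
    also have "\<dots> \<le> real (m - 1) * f a (b * k) + f a (b * k)"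
      using sub1 by (intro subadditive_mult_add_le)
    also have "\<dots> = real m * f a ((k - 1) * b + b)"
      using m k by (simp add: of_nat_diff algebra_simps)
    also have "\<dots> \<le> real m * (real (k - 1) * f a b + f a b)"
      using sub2 by (intro mult_left_mono subadditive_mult_add_le) auto
    also have "\<dots> = real m * real k * f a b"
      using k by (simp add: of_nat_diff algebra_simps)
    finally show "ln r / (real m * real k) \<le> y"
      using ab m k by (simp add: y divide_simps mult_ac)
  qed auto
  moreover have "entropy B = L"
  proof -
    have "((\<lambda>(a, b). f (a - 1) (b - 1) / (real a * real b)) \<longlongrightarrow> L) (at_top \<times>\<^sub>F at_top)"
      unfolding L_def using sub1 sub2 nonneg by (rule subadditive_div_Suc_tendsto)
    then have "((\<lambda>(a, b). ln (real (num_patterns B a b)) / (real a * real b)) \<longlongrightarrow> L) (at_top \<times>\<^sub>F at_top)"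
      \<comment> \<open>The set \<open>patterns B a b\<close> depends only on \<open>a - 1\<close>
        and \<open>b - 1\<close>, so \<open>Suc (a - 1)\<close> can replace \<open>a\<close> even
        for \<open>a = 0\<close>.\<close>
      by (simp add: f_def num_patterns_def patterns_def)
    then have lim: "Lim (at_top \<times>\<^sub>F at_top) (\<lambda>(a, b). ln (real (num_patterns B a b)) / (real a * real b)) = L"
      by (intro tendsto_Lim) (simp_all add: prod_filter_eq_bot)
    have "num_patterns B a b \<noteq> 0" if "a \<ge> 2" "b \<ge> 2" for a b
      using pos[of "a - 1" "b - 1"] that by simp
    then have "\<not> (\<exists>a\<ge>2. \<exists>b\<ge>2. num_patterns B a b = 0)" by blast
    with lim show ?thesis by (simp only: entropy_def if_False)
  qed
  ultimately show ?thesis by simp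
qed

lemma max_eigenvalue_eigenvalue:
  assumes "A \<in> carrier_mat n n" "n > 0" "\<And>i j. i < n \<Longrightarrow> j < n \<Longrightarrow> 0 \<le> A $$ (i, j)"
  shows "eigenvalue A (max_eigenvalue A)"
  using Max_in[OF card_finite_spectrum(1) spectrum_nonneg_mat_nonempty, of A n n] assms
  by (simp add: max_eigenvalue_def spectrum_def)

lemma max_eigenvalue_power_le_num_patterns:
  assumes B: "B \<subseteq> all_tiles" and \<beta>: "set \<beta> \<subseteq> {1, 4}" and m: "m \<ge> 1"
    and r: "r = max_eigenvalue (mat_prod (2 ^ m) (map (S_mat B m) \<beta>))" "r > 0"
  shows "r ^ (p * q) \<le> real (num_patterns B (Suc (p * m)) (Suc (q * length \<beta>)))"
proof -
  have fin: "finite B" using B finite_all_tiles by (rule finite_subset)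
  have "eigenvalue (mat_prod (2 ^ m) (map (S_mat B m) \<beta>)) r"
    unfolding r(1)
    by (intro max_eigenvalue_eigenvalue[where n = "2 ^ m"] mat_prod_carrier mat_prod_nonneg)
      (auto simp: S_mat_def)
  from eigenvalue_power_le_card_strips[OF B fin this r(2), of q]
  obtain k where k: "r ^ q \<le> real (card (strips B m (concat (replicate q \<beta>)) k))" by blast
  have "r ^ (p * q) = (r ^ q) ^ p" by (simp add: mult.commute flip: power_mult)
  also have "\<dots> \<le> real (card (strips B m (concat (replicate q \<beta>)) k)) ^ p"
    using k r(2) by (intro power_mono) auto
  also have "\<dots> \<le> real (num_patterns B (Suc (p * m)) (Suc (length (concat (replicate q \<beta>)))))"
    using card_strips_power_le[OF B fin m, of "concat (replicate q \<beta>)" k p] \<beta>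
    by (simp flip: of_nat_power add: set_replicate_conv_if del: of_nat_power)
  finally show ?thesis by (simp add: length_concat sum_list_replicate)
qed

text \<open>For \<open>r \<le> 0\<close> the left side is a positive multiple of
  \<open>-\<infinity>\<close>, so only positive \<open>r\<close> leave something to prove, and that
  over the reals.\<close>

lemma log_ereal_le_iff:
  assumes "c > 0"
  shows "ereal (1 / c) * log_ereal r \<le> ereal h \<longleftrightarrow> (r > 0 \<longrightarrow> ln r / c \<le> h)"
  using assms by (simp add: log_ereal_def)

theorem theorem3p1:
  fixes B :: "tile set" and \<beta> :: "nat list" and m :: nat
  assumes "B \<subseteq> all_tiles"
    and "set \<beta> \<subseteq> {1, 4}" and "length \<beta> \<ge> 1"
    and "m \<ge> 1"
  shows "ereal (entropy B) \<ge> ereal (1 / (real m * real (length \<beta>))) *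
           log_ereal (max_eigenvalue (mat_prod (2 ^ m) (map (S_mat B m) \<beta>))) \<and>
         ereal (entropy B) \<ge> ereal (1 / (real m * real (length \<beta>))) *
           log_ereal (max_eigenvalue (mat_prod (2 ^ m) (map (W_mat B m) \<beta>)))"
proof -
  have c: "real m * real (length \<beta>) > 0"
    using assms(3,4) by (intro mult_pos_pos) auto
  have fin: "finite B" using assms(1) finite_all_tiles by (rule finite_subset)
  have S: "ln r / (real m * real (length \<beta>)) \<le> entropy B"
    if "r = max_eigenvalue (mat_prod (2 ^ m) (map (S_mat B m) \<beta>))" "r > 0" for r
    using max_eigenvalue_power_le_num_patterns[OF assms(1,2,4) that]
    by (intro le_entropy fin assms that)
  have W: "ln r / (real m * real (length \<beta>)) \<le> entropy B"
    if r: "r = max_eigenvalue (mat_prod (2 ^ m) (map (W_mat B m) \<beta>))" "r > 0" for r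
  proof -
    let ?B = "tile_transpose ` B"
    have B': "?B \<subseteq> all_tiles" using assms(1) by (auto simp: all_tiles_def tile_transpose_def)
    have r': "r = max_eigenvalue (mat_prod (2 ^ m) (map (S_mat ?B m) \<beta>))"
      using r(1) assms(4) by (simp add: S_mat_transpose cong: map_cong)
    \<comment> \<open>Reflecting back to \<open>B\<close> exchanges width and height, so
      \<open>m\<close> and \<open>length \<beta>\<close> change roles, as do \<open>p\<close> and
      \<open>q\<close>.\<close>
    have "r ^ (q * p) \<le> real (num_patterns B (Suc (q * length \<beta>)) (Suc (p * m)))" for p q
      using max_eigenvalue_power_le_num_patterns[OF B' assms(2,4) r' r(2), of p q]
      by (simp add: num_patterns_transpose mult.commute)
    then have "ln r / (real (length \<beta>) * real m) \<le> entropy B"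
      by (intro le_entropy fin assms that)
    then show ?thesis by (simp add: mult.commute)
  qed
  from S W show ?thesis by (simp add: log_ereal_le_iff[OF c])
qed

end
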